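(* Let $N$ be a timelike ruled surface of type $N_-$ in $\mathbb{R}_1^3$ with timelike striction curve $\vec c$, curvatures $k_1,k_2$ and angle function $\theta$, and let $N^\gamma$ be a $\gamma$-transversal surface of $N$ with ruling $\vec q_\gamma=\mu\vec q+\eta\vec a$. Then $N^\gamma$ is developable if and only if $\tanh\theta=\dfrac{\eta}{\mu}$ holds or $\dfrac{k_1}{k_2}=\dfrac{\eta}{\mu}$ holds.
   Context: $\mathbb{R}_1^3$ is Minkowski 3-space with metric $\langle\cdot,\cdot\rangle=-dx_1^2+dx_2^2+dx_3^2$. A nonzero vector $\vec v$ is timelike if $\langle\vec v,\vec v\rangle<0$, null if $\langle\vec v,\vec v\rangle=0$, spacelike if $\langle\vec v,\vec v\rangle>0$. Setting. All functions are smooth on an open interval $I$, and equations between functions are identities on $I$. A timelike ruled surface of type $N_-$ with timelike striction curve is $\vec r(s,v)=\vec c(s)+v\vec q(s)$, with ruling direction $\vec q$ unit timelike, where $\vec c$ is its striction curve, a timelike curve parametrized by arc length $s$. It has a Frenet frame $\{\vec q,\vec h,\vec a\}$ of mutually orthogonal vectors, $\langle\vec q,\vec q\rangle=-1$, $\langle\vec h,\vec h\rangle=\langle\vec a,\vec a\rangle=1$ ($\vec h$ is the central normal, i.e. the surface normal along $\vec c$; $\vec a$ the central tangent), with $\vec q\,'=k_1\vec h$, $\vec h'=k_1\vec q+k_2\vec a$, $\vec a'=-k_2\vec h$ (prime is $d/ds$) for functions $k_1,k_2$. Standing assumption: the frame vectors and their derivatives are non-null, and $\vec q\,'\neq0$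 (i.e. $k_1\neq0$). The unit tangent of $\vec c$ is $\vec c\,'=\vec t=\cosh\theta\,\vec q+\sinh\theta\,\vec a$ for a real function $\theta$ (the hyperbolic angle between $\vec t$ and $\vec q$). $\gamma$-transversal surface. For a function $\gamma:I\to\mathbb{R}$, $N^\gamma$ is the ruled surface $\vec r_\gamma(s,v)=\vec c(s)+v\vec q_\gamma(s)$ with $\vec q_\gamma=\mu\vec q+\eta\vec a$, where $(\mu,\eta)=(\cosh\gamma,\sinh\gamma)$ if $\vec q_\gamma$ is timelike and $(\mu,\eta)=(\sinh\gamma,\cosh\gamma)$ if $\vec q_\gamma$ is spacelike; it is assumed that $\mu\ne0$ and $\eta\neq0$. A ruled surface $\vec f(s)+v\vec p(s)$ is developable if all its rulings are torsal, i.e. $\det(\vec f\,',\vec p,\vec p\,')=0$ for all $s$; equivalently, its distribution parameter $\det(\vec f\,',\vec p,\vec p\,')/\langle\vec p\,',\vec p\,'\rangle$ vanishes identically.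
   Formalization: The condition is proved pointwise: N^γ is developable iff at each s in I one of the two equations holds; with both read as identities on all of I, "only if" fails for smooth data, since a product of two smooth functions can vanish identically without either factor doing so. *)

theory Defs
  imports "HOL-Analysis.Analysis"
begin

definition mink :: "real^3 \<Rightarrow> real^3 \<Rightarrow> real" where
  "mink x y = - (x$1 * y$1) + x$2 * y$2 + x$3 * y$3"

definition timelike :: "real^3 \<Rightarrow> bool" where
  "timelike x \<longleftrightarrow> x \<noteq> 0 \<and> mink x x < 0"

definition null_vector :: "real^3 \<Rightarrow> bool" where
  "null_vector x \<longleftrightarrow> x \<noteq> 0 \<and> mink x x = 0"

definition spacelike :: "real^3 \<Rightarrow> bool" where
  "spacelike x \<longleftrightarrow> x \<noteq> 0 \<and> mink x x > 0"

(* D n is the n-th derivative of f on I; used only for open I, so the derivatives are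
   the ordinary two-sided ones. *)
definition smooth_on :: "real set \<Rightarrow> (real \<Rightarrow> 'a::real_normed_vector) \<Rightarrow> bool" where
  "smooth_on I f \<longleftrightarrow>
     (\<exists>D :: nat \<Rightarrow> real \<Rightarrow> 'a. (\<forall>s\<in>I. D 0 s = f s) \<and>
        (\<forall>n. \<forall>s\<in>I. (D n has_vector_derivative D (Suc n) s) (at s)))"

definition open_interval :: "real set \<Rightarrow> bool" where
  "open_interval I \<longleftrightarrow> open I \<and> is_interval I \<and> I \<noteq> {}"

abbreviation deriv_vec :: "(real \<Rightarrow> real^3) \<Rightarrow> real \<Rightarrow> real^3" where
  "deriv_vec f s \<equiv> vector_derivative f (at s)"

(* A ruled surface (s, v) \<mapsto> f s + v *\<^sub>R p s is given by its base curve f and its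
   ruling direction p. *)

definition striction_curve :: "real set \<Rightarrow> (real \<Rightarrow> real^3) \<Rightarrow> (real \<Rightarrow> real^3) \<Rightarrow> bool" where
  "striction_curve I f p \<longleftrightarrow> (\<forall>s\<in>I. mink (deriv_vec f s) (deriv_vec p s) = 0)"

definition torsal :: "(real \<Rightarrow> real^3) \<Rightarrow> (real \<Rightarrow> real^3) \<Rightarrow> real \<Rightarrow> bool" where
  "torsal f p s \<longleftrightarrow>
     det (vector [deriv_vec f s, p s, deriv_vec p s] :: real^3^3) = 0"

definition developable :: "real set \<Rightarrow> (real \<Rightarrow> real^3) \<Rightarrow> (real \<Rightarrow> real^3) \<Rightarrow> bool" where
  "developable I f p \<longleftrightarrow> (\<forall>s\<in>I. torsal f p s)"

(* The ruled surface with striction curve c and ruling q. Its tangent planes contain the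
   timelike vector q, so the surface is timelike. "Non-null" follows the convention that
   the zero vector is not null; in particular k2 may have zeros. *)
locale timelike_ruled_surface_N_minus =
  fixes I :: "real set"
    and c q h a :: "real \<Rightarrow> real^3"
    and k1 k2 \<theta> :: "real \<Rightarrow> real"
  assumes interval: "open_interval I"
    and smooth: "smooth_on I c" "smooth_on I q" "smooth_on I h" "smooth_on I a"
      "smooth_on I k1" "smooth_on I k2" "smooth_on I \<theta>"
    and striction: "striction_curve I c q"
    and arc_length: "\<And>s. s \<in> I \<Longrightarrow> mink (deriv_vec c s) (deriv_vec c s) = -1"
    and frame_norms: "\<And>s. s \<in> I \<Longrightarrow> mink (q s) (q s) = -1"
      "\<And>s. s \<in> I \<Longrightarrow> mink (h s) (h s) = 1"
      "\<And>s. s \<in> I \<Longrightarrow> mink (a s) (a s) = 1"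
    and frame_orthogonal: "\<And>s. s \<in> I \<Longrightarrow> mink (q s) (h s) = 0"
      "\<And>s. s \<in> I \<Longrightarrow> mink (q s) (a s) = 0"
      "\<And>s. s \<in> I \<Longrightarrow> mink (h s) (a s) = 0"
    and frenet: "\<And>s. s \<in> I \<Longrightarrow> deriv_vec q s = k1 s *\<^sub>R h s"
      "\<And>s. s \<in> I \<Longrightarrow> deriv_vec h s = k1 s *\<^sub>R q s + k2 s *\<^sub>R a s"
      "\<And>s. s \<in> I \<Longrightarrow> deriv_vec a s = - k2 s *\<^sub>R h s"
    and non_null: "\<And>s. s \<in> I \<Longrightarrow> \<not> null_vector (q s)"
      "\<And>s. s \<in> I \<Longrightarrow> \<not> null_vector (h s)"
      "\<And>s. s \<in> I \<Longrightarrow> \<not> null_vector (a s)"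
      "\<And>s. s \<in> I \<Longrightarrow> \<not> null_vector (deriv_vec q s)"
      "\<And>s. s \<in> I \<Longrightarrow> \<not> null_vector (deriv_vec h s)"
      "\<And>s. s \<in> I \<Longrightarrow> \<not> null_vector (deriv_vec a s)"
    and deriv_q_nonzero: "\<And>s. s \<in> I \<Longrightarrow> deriv_vec q s \<noteq> 0"
    and tangent: "\<And>s. s \<in> I \<Longrightarrow>
      deriv_vec c s = cosh (\<theta> s) *\<^sub>R q s + sinh (\<theta> s) *\<^sub>R a s"

definition transversal_ruling ::
  "(real \<Rightarrow> real) \<Rightarrow> (real \<Rightarrow> real) \<Rightarrow> (real \<Rightarrow> real^3) \<Rightarrow> (real \<Rightarrow> real^3) \<Rightarrow> real \<Rightarrow> real^3" where
  "transversal_ruling \<mu> \<eta> q a = (\<lambda>s. \<mu> s *\<^sub>R q s + \<eta> s *\<^sub>R a s)"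

definition transversal_coeffs ::
  "real set \<Rightarrow> (real \<Rightarrow> real^3) \<Rightarrow> (real \<Rightarrow> real^3) \<Rightarrow>
   (real \<Rightarrow> real) \<Rightarrow> (real \<Rightarrow> real) \<Rightarrow> (real \<Rightarrow> real) \<Rightarrow> bool" where
  "transversal_coeffs I q a \<gamma> \<mu> \<eta> \<longleftrightarrow>
     smooth_on I \<gamma> \<and> (\<forall>s\<in>I. \<mu> s \<noteq> 0 \<and> \<eta> s \<noteq> 0) \<and>
     ((\<forall>s\<in>I. timelike (transversal_ruling \<mu> \<eta> q a s) \<and>
             \<mu> s = cosh (\<gamma> s) \<and> \<eta> s = sinh (\<gamma> s)) \<or>
      (\<forall>s\<in>I. spacelike (transversal_ruling \<mu> \<eta> q a s) \<and>
             \<mu> s = sinh (\<gamma> s) \<and> \<eta> s = cosh (\<gamma> s)))"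

end

theory Submission
  imports Defs
begin

text \<open>The derivative of \<open>\<mu> q + \<eta> a\<close> has no component other than \<open>(\<mu> k1 - \<eta> k2) h\<close> outside the plane
  of \<open>q\<close> and \<open>a\<close>, which contains the ruling and the tangent of the striction curve. So the
  determinant deciding torsality is
  \<open>(\<mu> k1 - \<eta> k2) (\<mu> sinh \<theta> - \<eta> cosh \<theta>)\<close> times the nonzero determinant of the frame.\<close>

text \<open>\<open>D 0\<close> agrees with \<open>f\<close> only on \<open>I\<close>, but
  \<open>I\<close> is a neighbourhood of \<open>s\<close>, so the derivative carries over.\<close>

lemma smooth_on_imp_differentiable:
  assumes "smooth_on I f" "open I" "s \<in> I"
  shows "f differentiable (at s)"
proof -
  obtain D where D: "\<forall>s\<in>I. D 0 s = f s"
    "\<forall>n. \<forall>s\<in>I. (D n has_vector_derivative D (Suc n) s) (at s)"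
    using assms(1) unfolding smooth_on_def by blast
  have "(f has_vector_derivative D (Suc 0) s) (at s)"
    by (rule has_vector_derivative_transform_within_open[of "D 0" _ s I]) (use D assms in auto)
  then show ?thesis
    by (rule differentiableI_vector)
qed

text \<open>For the matrix \<open>M\<close> with rows \<open>x\<close>, \<open>y\<close>,
  \<open>z\<close> and \<open>J = diag(-1, 1, 1)\<close>, the Gram matrix is \<open>M J M^T\<close>;
  the sign is \<open>det J = -1\<close>.\<close>

lemma det_squared_eq_minus_gram:
  fixes x y z :: "real^3"
  shows "(det (vector [x, y, z] :: real^3^3))\<^sup>2 =
    - det (vector [vector [mink x x, mink x y, mink x z],
                   vector [mink x y, mink y y, mink y z],
                   vector [mink x z, mink y z, mink z z]] :: real^3^3)"
  unfolding det_3 mink_def vector_3 by algebra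

text \<open>The coefficient matrix has middle column \<open>(0, 0, \<kappa>)\<close>. Expanding
  along it leaves a 2x2 minor free of \<open>\<mu>'\<close> and \<open>\<eta>'\<close>.\<close>

lemma det_combination_in_frame:
  fixes x y z :: "real^3"
  shows "det (vector [\<alpha> *\<^sub>R x + \<beta> *\<^sub>R z, \<mu> *\<^sub>R x + \<eta> *\<^sub>R z,
      \<mu>' *\<^sub>R x + \<kappa> *\<^sub>R y + \<eta>' *\<^sub>R z] :: real^3^3) =
    \<kappa> * (\<beta> * \<mu> - \<alpha> * \<eta>) * det (vector [x, y, z] :: real^3^3)"
  unfolding det_3 vector_3 by (simp add: algebra_simps)

text \<open>Smoothness is given for \<open>\<gamma>\<close> only; on the open set \<open>I\<close>
  the coefficients are \<open>cosh\<close> and \<open>sinh\<close> of \<open>\<gamma>\<close> in one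
  order or the other, and inherit differentiability.\<close>

lemma transversal_coeffs_differentiable:
  assumes "transversal_coeffs I q a \<gamma> \<mu> \<eta>" "open I" "s \<in> I"
  shows "\<mu> differentiable (at s)" "\<eta> differentiable (at s)"
proof -
  have "\<gamma> differentiable (at s)"
    using assms smooth_on_imp_differentiable unfolding transversal_coeffs_def by blast
  then obtain g where g: "(\<gamma> has_real_derivative g) (at s)"
    by (auto simp: real_differentiable_def)
  have ch: "((\<lambda>t. cosh (\<gamma> t)) has_real_derivative sinh (\<gamma> s) * g) (at s)"
    and sh: "((\<lambda>t. sinh (\<gamma> t)) has_real_derivative cosh (\<gamma> s) * g) (at s)"
    by (auto intro!: derivative_eq_intros g)
  have transfer: "f differentiable (at s)"
    if "(f' has_real_derivative d) (at s)" "\<And>t. t \<in> I \<Longrightarrow> f t = f' t" for f f' d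
    using has_field_derivative_transform_within_open[OF that(1) assms(2,3), of f] that(2)
    by (auto simp: real_differentiable_def)
  show "\<mu> differentiable (at s)" "\<eta> differentiable (at s)"
    using assms(1) transfer[OF ch] transfer[OF sh] unfolding transversal_coeffs_def by metis+
qed

context timelike_ruled_surface_N_minus
begin

lemma det_frame_nonzero:
  assumes "s \<in> I"
  shows "det (vector [q s, h s, a s] :: real^3^3) \<noteq> 0"
proof -
  \<comment> \<open>The Gram matrix of the frame is \<open>diag(-1, 1, 1)\<close>.\<close>
  have "(det (vector [q s, h s, a s] :: real^3^3))\<^sup>2 = 1"
    unfolding det_squared_eq_minus_gram
    by (simp add: det_3 frame_norms frame_orthogonal assms)
  then show ?thesis
    by auto
qed

lemma curvature_nonzero: "s \<in> I \<Longrightarrow> k1 s \<noteq> 0"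
  using deriv_q_nonzero frenet(1) by force

lemma deriv_transversal_ruling:
  assumes "s \<in> I" "(\<mu> has_real_derivative \<mu>') (at s)" "(\<eta> has_real_derivative \<eta>') (at s)"
  shows "deriv_vec (transversal_ruling \<mu> \<eta> q a) s =
    \<mu>' *\<^sub>R q s + (\<mu> s * k1 s - \<eta> s * k2 s) *\<^sub>R h s + \<eta>' *\<^sub>R a s"
proof (rule vector_derivative_at)
  have "open I"
    using interval by (simp add: open_interval_def)
  \<comment> \<open>The Frenet equations only state values of \<open>vector_derivative\<close>;
    smoothness makes these genuine derivatives.\<close>
  then have "(q has_vector_derivative k1 s *\<^sub>R h s) (at s)"
    and "(a has_vector_derivative - k2 s *\<^sub>R h s) (at s)"
    using smooth_on_imp_differentiable smooth(2,4) assms(1) frenet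
    by (metis vector_derivative_works)+
  then show "(transversal_ruling \<mu> \<eta> q a has_vector_derivative
      \<mu>' *\<^sub>R q s + (\<mu> s * k1 s - \<eta> s * k2 s) *\<^sub>R h s + \<eta>' *\<^sub>R a s) (at s)"
    unfolding transversal_ruling_def
    by (auto intro!: derivative_eq_intros assms(2,3) simp: algebra_simps)
qed

lemma torsal_transversal_iff:
  assumes "s \<in> I" "\<mu> differentiable (at s)" "\<eta> differentiable (at s)"
  shows "torsal c (transversal_ruling \<mu> \<eta> q a) s \<longleftrightarrow>
    sinh (\<theta> s) * \<mu> s = cosh (\<theta> s) * \<eta> s \<or> \<mu> s * k1 s = \<eta> s * k2 s"
proof -
  obtain \<mu>' \<eta>' where "(\<mu> has_real_derivative \<mu>') (at s)" "(\<eta> has_real_derivative \<eta>') (at s)"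
    using assms(2,3) by (auto simp: real_differentiable_def)
  then have "det (vector [deriv_vec c s, transversal_ruling \<mu> \<eta> q a s,
        deriv_vec (transversal_ruling \<mu> \<eta> q a) s] :: real^3^3) =
      (\<mu> s * k1 s - \<eta> s * k2 s) * (sinh (\<theta> s) * \<mu> s - cosh (\<theta> s) * \<eta> s) *
      det (vector [q s, h s, a s] :: real^3^3)"
    \<comment> \<open>Here \<alpha> and \<beta> are \<open>cosh (\<theta> s)\<close> and
      \<open>sinh (\<theta> s)\<close>, and \<kappa> is the \<open>h\<close>-component of the
      derivative of the ruling.\<close>
    using det_combination_in_frame
    by (simp add: tangent[OF assms(1)] deriv_transversal_ruling[OF assms(1)])
       (simp add: transversal_ruling_def)
  then show ?thesis
    unfolding torsal_def using det_frame_nonzero[OF assms(1)] by auto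
qed

end

theorem theorem6p5:
  fixes I :: "real set"
    and c q h a :: "real \<Rightarrow> real^3"
    and k1 k2 \<theta> \<gamma> \<mu> \<eta> :: "real \<Rightarrow> real"
  assumes "timelike_ruled_surface_N_minus I c q h a k1 k2 \<theta>"
    and "transversal_coeffs I q a \<gamma> \<mu> \<eta>"
  shows "developable I c (transversal_ruling \<mu> \<eta> q a) \<longleftrightarrow>
    (\<forall>s\<in>I. tanh (\<theta> s) = \<eta> s / \<mu> s \<or> k1 s / k2 s = \<eta> s / \<mu> s)"
proof -
  interpret timelike_ruled_surface_N_minus I c q h a k1 k2 \<theta>
    by fact
  \<comment> \<open>The equivalence holds at each point separately, so which alternative holds may
    change with \<open>s\<close>.\<close>
  have "torsal c (transversal_ruling \<mu> \<eta> q a) s \<longleftrightarrow>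
      tanh (\<theta> s) = \<eta> s / \<mu> s \<or> k1 s / k2 s = \<eta> s / \<mu> s" if s: "s \<in> I" for s
  proof -
    have \<mu>: "\<mu> s \<noteq> 0" and \<eta>: "\<eta> s \<noteq> 0"
      using assms(2) s by (auto simp: transversal_coeffs_def)
    \<comment> \<open>Cross-multiplication is allowed because \<open>cosh\<close> never
      vanishes.\<close>
    have "tanh (\<theta> s) = \<eta> s / \<mu> s \<longleftrightarrow> sinh (\<theta> s) * \<mu> s = cosh (\<theta> s) * \<eta> s"
      using \<mu> by (simp add: tanh_def frac_eq_eq mult.commute)
    moreover have "k1 s / k2 s = \<eta> s / \<mu> s \<longleftrightarrow> \<mu> s * k1 s = \<eta> s * k2 s"
      \<comment> \<open>Where \<open>k2\<close> vanishes both sides fail: the left one because \<open>k1 s / 0 = 0\<close>.\<close>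
      using \<mu> \<eta> curvature_nonzero[OF s]
      by (cases "k2 s = 0") (auto simp: frac_eq_eq mult.commute)
    moreover have "open I"
      using interval by (simp add: open_interval_def)
    ultimately show ?thesis
      using torsal_transversal_iff[OF s] transversal_coeffs_differentiable[OF assms(2) _ s]
      by blast
  qed
  then show ?thesis
    by (simp add: developable_def)
qed

end
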